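(* Let $\gamma,\eta,\lambda\in\mathbb{R}$, $a\in\mathbb{C}$, $k\in\mathbb{N}_0$, $m\in\mathbb{N}$ and $n\in\mathbb{N}_0$. Then $${}_{\mathfrak{B}}\mathfrak{D}_{n,a}^{[k,m-1]}(\gamma,\eta;\lambda)=\sum_{j=0}^{n}\binom{n}{j}\,\mathfrak{D}_{n-j}^{(k)}(\gamma)\,\mathfrak{B}_{j,a}^{[m-1]}(\eta;\lambda),$$ where ${}_{\mathfrak{B}}\mathfrak{D}_{n,a}^{[k,m-1]}$ are the generalized Apostol-Bernoulli poly-Daehee polynomials, $\mathfrak{D}_n^{(k)}$ the poly-Daehee polynomials, and $\mathfrak{B}_{j,a}^{[m-1]}$ the generalized Apostol-Bernoulli polynomials.
   Context: $\mathbb{N}=\{1,2,\dots\}$, $\mathbb{N}_0=\mathbb{N}\cup\{0\}$. The polylogarithm is $\mathrm{Li}_k(z)=\sum_{r=1}^{\infty} z^r/r^k$. Generalized Apostol-Bernoulli poly-Daehee polynomials (GABPDP), defined by the generating function $$(1+x)^{\gamma}\,\frac{\log(1+x)}{\mathrm{Li}_k(1-e^{-x})}\,e^{\eta x}\left(\frac{x^m}{\lambda e^x-\sum_{l=0}^{m-1}\frac{x^l}{l!}}\right)^{a}=\sum_{n=0}^\infty {}_{\mathfrak{B}}\mathfrak{D}_{n,a}^{[k,m-1]}(\gamma,\eta;\lambda)\frac{x^n}{n!}.$$ Poly-Daehee polynomials: $(1+x)^{\gamma}\frac{\log(1+x)}{\mathrm{Li}_k(1-e^{-x})}=\sum_{n=0}^\infty\mathfrak{D}_n^{(k)}(\gamma)\frac{x^n}{n!}$.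 Generalized Apostol-Bernoulli polynomials of order $a\in\mathbb{C}$: $$e^{\eta x}\left(\frac{x^m}{\lambda e^x-\sum_{l=0}^{m-1}\frac{x^l}{l!}}\right)^{a}=\sum_{n=0}^\infty\mathfrak{B}_{n,a}^{[m-1]}(\eta;\lambda)\frac{x^n}{n!}.$$ *)

theory Defs
  imports "HOL-Analysis.Complex_Transcendental"
begin

text \<open>
  The real or complex numbers \<open>c 0, c 1, ...\<close> have \<open>f\<close> as their exponential generating
  function. The equation is required on a punctured neighbourhood of \<open>0\<close> because the generating
  functions below are quotients of the form \<open>0/0\<close> at \<open>x = 0\<close>, where the usual convention is to
  take the continuous extension. The variable \<open>x\<close> is real: this already determines \<open>c\<close>, and
  it asks less than an expansion in a complex neighbourhood.
\<close>

definition has_egf :: "(real \<Rightarrow> 'a::real_normed_field) \<Rightarrow> (nat \<Rightarrow> 'a) \<Rightarrow> bool" where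
  "has_egf f c \<longleftrightarrow> (\<forall>\<^sub>F x in at 0. (\<lambda>n. c n * of_real x ^ n / fact n) sums f x)"

text \<open>
  Coefficients are set to \<open>0\<close> for a function without such an expansion. This only concerns
  the powers with exponent \<open>a\<close> below: if \<open>lam \<noteq> 1\<close>, the base is \<open>x ^ m\<close> times a
  function that is analytic and nonzero at \<open>0\<close>, so that its power has a Taylor expansion for
  \<open>a\<close> in \<open>{0, 1, 2, ...}\<close> but not, for instance, for \<open>a = -1\<close>. If \<open>lam = 1\<close>, the base
  tends to \<open>m!\<close> and every complex \<open>a\<close> is admissible.
\<close>

definition egf_coeff :: "(real \<Rightarrow> 'a::real_normed_field) \<Rightarrow> nat \<Rightarrow> 'a" where
  "egf_coeff f n = (if \<exists>c. has_egf f c then (THE c. has_egf f c) n else 0)"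

definition polylog :: "nat \<Rightarrow> real \<Rightarrow> real" where
  "polylog k z = (\<Sum>r. z ^ Suc r / real (Suc r) ^ k)"

definition poly_Daehee_gf :: "nat \<Rightarrow> real \<Rightarrow> real \<Rightarrow> real" where
  "poly_Daehee_gf k \<gamma> x = (1 + x) powr \<gamma> * (ln (1 + x) / polylog k (1 - exp (- x)))"

text \<open>The complex power is the principal one.\<close>

definition apostol_bernoulli_gf :: "nat \<Rightarrow> complex \<Rightarrow> real \<Rightarrow> real \<Rightarrow> real \<Rightarrow> complex" where
  "apostol_bernoulli_gf m a \<eta> lam x =
     of_real (exp (\<eta> * x)) *
     of_real (x ^ m / (lam * exp x - (\<Sum>l<m. x ^ l / fact l))) powr a"

definition GABPDP_gf ::
  "nat \<Rightarrow> nat \<Rightarrow> complex \<Rightarrow> real \<Rightarrow> real \<Rightarrow> real \<Rightarrow> real \<Rightarrow> complex" where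
  "GABPDP_gf k m a \<gamma> \<eta> lam x =
     of_real ((1 + x) powr \<gamma> * (ln (1 + x) / polylog k (1 - exp (- x))) * exp (\<eta> * x)) *
     of_real (x ^ m / (lam * exp x - (\<Sum>l<m. x ^ l / fact l))) powr a"

text \<open>
  In the following, the argument \<open>m\<close> stands for the upper index \<open>m - 1\<close> of the usual notation.
\<close>

definition poly_Daehee :: "nat \<Rightarrow> nat \<Rightarrow> real \<Rightarrow> real" where
  "poly_Daehee k n \<gamma> = egf_coeff (poly_Daehee_gf k \<gamma>) n"

definition apostol_bernoulli :: "nat \<Rightarrow> complex \<Rightarrow> nat \<Rightarrow> real \<Rightarrow> real \<Rightarrow> complex" where
  "apostol_bernoulli m a n \<eta> lam = egf_coeff (apostol_bernoulli_gf m a \<eta> lam) n"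

definition GABPDP ::
  "nat \<Rightarrow> nat \<Rightarrow> complex \<Rightarrow> nat \<Rightarrow> real \<Rightarrow> real \<Rightarrow> real \<Rightarrow> complex" where
  "GABPDP k m a n \<gamma> \<eta> lam = egf_coeff (GABPDP_gf k m a \<gamma> \<eta> lam) n"

end

theory Submission
  imports Defs "HOL-Complex_Analysis.Complex_Analysis"
begin

text \<open>
  The poly-Daehee generating function is analytic at \<open>0\<close> with a nonzero constant term, so it and
  its reciprocal both have exponential generating expansions. If the Apostol-Bernoulli function has
  an expansion, the identity is the Cauchy product. Otherwise the product with the poly-Daehee
  function has no expansion either, since dividing by that function would give one for the
  Apostol-Bernoulli function, and all coefficients involved are \<open>0\<close> by convention.
\<close>

section \<open>Exponential generating expansions as convergent power series, and their
  uniqueness\<close>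

lemma eventually_norm_less_fps_conv_radius:
  fixes F :: "'a::{banach, real_normed_field} fps"
  assumes "fps_conv_radius F > 0"
  shows "\<forall>\<^sub>F x::real in at 0. ereal (norm (of_real x :: 'a)) < fps_conv_radius F"
proof -
  obtain r where "0 < ereal r" "ereal r < fps_conv_radius F"
    using ereal_dense2[OF assms] by blast
  then show ?thesis
    unfolding eventually_at by (intro exI[of _ r]) (auto intro: less_trans[of _ "ereal r"])
qed

text \<open>Dividing \<open>c n\<close> by \<open>n!\<close> turns the expansion into an ordinary
  power series, so that the calculus of formal power series applies. Only real points near 0 are
  given, but one nonzero point of convergence already forces a positive radius.\<close>

lemma has_egf_iff_eval_fps:
  fixes f :: "real \<Rightarrow> 'a::{banach, real_normed_field}"
  shows "has_egf f c \<longleftrightarrow> fps_conv_radius (Abs_fps (\<lambda>n. c n / fact n)) > 0 \<and>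
    (\<forall>\<^sub>F x in at 0. f x = eval_fps (Abs_fps (\<lambda>n. c n / fact n)) (of_real x))"
    (is "_ \<longleftrightarrow> fps_conv_radius ?F > 0 \<and> _")
proof safe
  assume f: "has_egf f c"
  then have ev: "\<forall>\<^sub>F x in at 0. x \<noteq> 0 \<and> (\<lambda>n. fps_nth ?F n * of_real x ^ n) sums f x"
    unfolding has_egf_def
    by (auto simp: eventually_at_filter elim!: eventually_mono)
  then obtain x where x: "x \<noteq> 0" "(\<lambda>n. fps_nth ?F n * of_real x ^ n) sums f x"
    using eventually_happens'[OF _ ev] by auto
  have "ereal (norm (of_real x :: 'a)) \<le> fps_conv_radius ?F"
    unfolding fps_conv_radius_def using x(2) by (intro conv_radius_geI) (auto simp: sums_iff)
  moreover have "0 < ereal (norm (of_real x :: 'a))"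
    using x(1) by simp
  ultimately show "fps_conv_radius ?F > 0"
    by (rule less_le_trans[rotated])
  show "\<forall>\<^sub>F x in at 0. f x = eval_fps ?F (of_real x)"
    using ev by eventually_elim (simp add: eval_fps_def sums_iff)
next
  assume r: "fps_conv_radius ?F > 0" and f: "\<forall>\<^sub>F x in at 0. f x = eval_fps ?F (of_real x)"
  show "has_egf f c"
    unfolding has_egf_def using eventually_norm_less_fps_conv_radius[OF r] f
  proof eventually_elim
    case (elim x)
    then show ?case
      using sums_eval_fps[of "of_real x :: 'a" ?F] by simp
  qed
qed

lemma has_egfI:
  fixes f :: "real \<Rightarrow> 'a::{banach, real_normed_field}"
  assumes "fps_conv_radius F > 0" "\<forall>\<^sub>F x in at 0. f x = eval_fps F (of_real x)"
  shows "has_egf f (\<lambda>n. fact n * fps_nth F n)"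
  using assms by (simp add: has_egf_iff_eval_fps fps_nth_inverse)

text \<open>If the difference were nonzero, dividing it by its lowest power of the variable would
  leave a series \<open>K\<close> with nonzero constant term. But \<open>K\<close> vanishes at all
  small nonzero real points, so by continuity it vanishes at 0 as well.\<close>

lemma fps_eqI_eval_fps_of_real:
  fixes F G :: "'a::{banach, real_normed_field} fps"
  assumes "fps_conv_radius F > 0" "fps_conv_radius G > 0"
    and "\<forall>\<^sub>F x::real in at 0. eval_fps F (of_real x) = eval_fps G (of_real x)"
  shows "F = G"
proof (rule ccontr)
  assume "F \<noteq> G"
  define H where "H = F - G"
  define K where "K = fps_shift (subdegree H) H"
  have "H \<noteq> 0" using \<open>F \<noteq> G\<close> by (simp add: H_def)
  have "0 < min (fps_conv_radius F) (fps_conv_radius G)"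
    using assms(1,2) by simp
  also have "\<dots> \<le> fps_conv_radius H"
    unfolding H_def by (rule fps_conv_radius_diff)
  finally have H: "fps_conv_radius H > 0" .
  have "\<forall>\<^sub>F x::real in at 0. x \<noteq> 0"
    by (simp add: eventually_at_filter)
  then have "\<forall>\<^sub>F x::real in at 0. eval_fps K (of_real x) = 0"
    using eventually_norm_less_fps_conv_radius[OF assms(1)]
      eventually_norm_less_fps_conv_radius[OF assms(2)]
      eventually_norm_less_fps_conv_radius[OF H] assms(3)
  proof eventually_elim
    case (elim x)
    then have "eval_fps H (of_real x) = 0"
      by (simp add: H_def eval_fps_diff)
    with elim show ?case
      unfolding K_def by (subst eval_fps_shift) auto
  qed
  then have "((\<lambda>x::real. eval_fps K (of_real x)) \<longlongrightarrow> 0) (at 0)"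
    by (rule tendsto_eventually)
  moreover have "((\<lambda>x::real. eval_fps K (of_real x)) \<longlongrightarrow> eval_fps K (of_real 0)) (at 0)"
  proof (rule isCont_tendsto_compose[where g = "eval_fps K"])
    show "isCont (eval_fps K) (of_real 0)"
      using H by (intro continuous_eval_fps) (simp add: K_def zero_ereal_def)
    show "((\<lambda>x::real. of_real x :: 'a) \<longlongrightarrow> of_real 0) (at 0)"
      by (intro tendsto_intros)
  qed
  ultimately have "eval_fps K (of_real 0) = 0"
    using LIM_unique by blast
  with \<open>H \<noteq> 0\<close> show False
    by (simp add: K_def eval_fps_at_0)
qed

lemma has_egf_unique:
  fixes f :: "real \<Rightarrow> 'a::{banach, real_normed_field}"
  assumes "has_egf f c" "has_egf f d"
  shows "c = d"
proof -
  have c: "fps_conv_radius (Abs_fps (\<lambda>n. c n / fact n)) > 0"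
      "\<forall>\<^sub>F x in at 0. f x = eval_fps (Abs_fps (\<lambda>n. c n / fact n)) (of_real x)"
    and d: "fps_conv_radius (Abs_fps (\<lambda>n. d n / fact n)) > 0"
      "\<forall>\<^sub>F x in at 0. f x = eval_fps (Abs_fps (\<lambda>n. d n / fact n)) (of_real x)"
    using assms by (simp_all add: has_egf_iff_eval_fps)
  have "\<forall>\<^sub>F x::real in at 0. eval_fps (Abs_fps (\<lambda>n. c n / fact n)) (of_real x)
      = eval_fps (Abs_fps (\<lambda>n. d n / fact n)) (of_real x)"
    using c(2) d(2) by eventually_elim simp
  then have "Abs_fps (\<lambda>n. c n / fact n) = Abs_fps (\<lambda>n. d n / fact n)"
    using fps_eqI_eval_fps_of_real c(1) d(1) by blast
  then show ?thesis
    by (simp add: fps_eq_iff fun_eq_iff)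
qed

lemma egf_coeff_eqI:
  fixes f :: "real \<Rightarrow> 'a::{banach, real_normed_field}"
  assumes "has_egf f c"
  shows "egf_coeff f = c"
proof -
  have "(THE c. has_egf f c) = c"
    using assms has_egf_unique by blast
  with assms show ?thesis
    by (auto simp: egf_coeff_def fun_eq_iff)
qed

section \<open>Products and reciprocals of expansions\<close>

lemma has_egf_cong:
  assumes "\<forall>\<^sub>F x in at 0. f x = g x"
  shows "has_egf f c \<longleftrightarrow> has_egf g c"
  unfolding has_egf_def by (rule eventually_cong[OF assms]) simp

lemma has_egf_mult:
  fixes f g :: "real \<Rightarrow> 'a::{banach, real_normed_field}"
  assumes "has_egf f c" "has_egf g d"
  shows "has_egf (\<lambda>x. f x * g x) (\<lambda>n. \<Sum>j=0..n. of_nat (n choose j) * c (n - j) * d j)"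
proof -
  define F G where "F = Abs_fps (\<lambda>n. c n / fact n)" and "G = Abs_fps (\<lambda>n. d n / fact n)"
  have F: "fps_conv_radius F > 0" "\<forall>\<^sub>F x in at 0. f x = eval_fps F (of_real x)"
    and G: "fps_conv_radius G > 0" "\<forall>\<^sub>F x in at 0. g x = eval_fps G (of_real x)"
    using assms by (simp_all add: has_egf_iff_eval_fps F_def G_def)
  \<comment> \<open>The order \<open>G * F\<close> makes the Cauchy product pair \<open>d j\<close>
    with \<open>c (n - j)\<close>, as in the claimed sum.\<close>
  have "0 < min (fps_conv_radius G) (fps_conv_radius F)"
    using F G by simp
  also have "\<dots> \<le> fps_conv_radius (G * F)"
    by (rule fps_conv_radius_mult)
  finally have "has_egf (\<lambda>x. f x * g x) (\<lambda>n. fact n * fps_nth (G * F) n)"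
  proof (rule has_egfI)
    show "\<forall>\<^sub>F x in at 0. f x * g x = eval_fps (G * F) (of_real x)"
      using eventually_norm_less_fps_conv_radius[OF F(1)]
        eventually_norm_less_fps_conv_radius[OF G(1)] F(2) G(2)
      by eventually_elim (simp add: eval_fps_mult mult.commute)
  qed
  also have "(\<lambda>n. fact n * fps_nth (G * F) n) =
      (\<lambda>n. \<Sum>j=0..n. of_nat (n choose j) * c (n - j) * d j)"
  proof
    fix n
    have "fact n * fps_nth (G * F) n = (\<Sum>j=0..n. fact n * (d j / fact j * (c (n - j) / fact (n - j))))"
      by (simp only: fps_mult_nth sum_distrib_left) (simp add: F_def G_def)
    also have "\<dots> = (\<Sum>j=0..n. of_nat (n choose j) * c (n - j) * d j)"
      by (intro sum.cong) (auto simp: binomial_fact field_simps)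
    finally show "fact n * fps_nth (G * F) n = (\<Sum>j=0..n. of_nat (n choose j) * c (n - j) * d j)" .
  qed
  finally show ?thesis .
qed

text \<open>A series with nonzero constant term has a formal inverse, again of positive radius. The
  second conclusion is what later permits cancelling \<open>f x\<close> against its inverse.\<close>

lemma has_egf_inverse:
  fixes f :: "real \<Rightarrow> 'a::{banach, real_normed_field}"
  assumes "has_egf f c" "c 0 \<noteq> 0"
  obtains d where "has_egf (\<lambda>x. inverse (f x)) d" "\<forall>\<^sub>F x in at 0. f x \<noteq> 0"
proof -
  define F where "F = Abs_fps (\<lambda>n. c n / fact n)"
  have F: "fps_conv_radius F > 0" "\<forall>\<^sub>F x in at 0. f x = eval_fps F (of_real x)"
    using assms by (simp_all add: has_egf_iff_eval_fps F_def)
  have F0: "fps_nth F 0 \<noteq> 0"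
    using assms(2) by (simp add: F_def)
  have I: "fps_conv_radius (inverse F) > 0"
    by (rule fps_conv_radius_inverse_pos[OF F0 F(1)])
  have inv: "\<forall>\<^sub>F x in at 0. eval_fps (inverse F) (of_real x) * f x = 1"
    using eventually_norm_less_fps_conv_radius[OF F(1)]
      eventually_norm_less_fps_conv_radius[OF I] F(2)
  proof eventually_elim
    case (elim x)
    then have "eval_fps (inverse F) (of_real x) * f x = eval_fps (inverse F * F) (of_real x)"
      by (simp add: eval_fps_mult)
    then show ?case
      by (simp add: inverse_mult_eq_1[OF F0])
  qed
  show thesis
  proof (rule that)
    show "has_egf (\<lambda>x. inverse (f x)) (\<lambda>n. fact n * fps_nth (inverse F) n)"
    proof (rule has_egfI[OF I])
      show "\<forall>\<^sub>F x in at 0. inverse (f x) = eval_fps (inverse F) (of_real x)"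
        using inv by eventually_elim (metis inverse_unique mult.commute)
    qed
    show "\<forall>\<^sub>F x in at 0. f x \<noteq> 0"
      using inv by eventually_elim auto
  qed
qed

section \<open>Passing between real and complex coefficients\<close>

lemma has_egf_of_real:
  assumes "has_egf f c"
  shows "has_egf (\<lambda>x. of_real (f x) :: complex) (\<lambda>n. of_real (c n))"
  using assms unfolding has_egf_def
proof eventually_elim
  case (elim x)
  then have "(\<lambda>n. complex_of_real (c n * of_real x ^ n / fact n)) sums of_real (f x)"
    by (rule sums_of_real)
  then show ?case by simp
qed

text \<open>Since \<open>x\<close> is real, \<open>x ^ n / fact n\<close> is a real factor and comes
  out of \<open>Re\<close>. This brings expansions found by complex analysis back to real
  functions.\<close>

lemma has_egf_Re:
  assumes "has_egf f c"
  shows "has_egf (\<lambda>x. Re (f x)) (\<lambda>n. Re (c n))"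
  using assms unfolding has_egf_def
proof eventually_elim
  case (elim x)
  have "Re (c n * of_real x ^ n / fact n) = Re (c n) * of_real x ^ n / fact n" for n
  proof -
    have "c n * of_real x ^ n / fact n = of_real (x ^ n / fact n) * c n" by simp
    then show ?thesis by (simp del: of_real_divide of_real_power)
  qed
  with sums_Re[OF elim] show ?case by simp
qed

section \<open>The polylogarithm and the poly-Daehee generating function\<close>

lemma fps_conv_radius_polylog:
  "fps_conv_radius (Abs_fps (\<lambda>n. 1 / of_nat (Suc n) ^ k :: complex)) \<ge> 1"
  unfolding fps_conv_radius_def
proof (rule conv_radius_geI_ex')
  fix r :: real assume r: "0 < r" "ereal r < 1"
  show "summable (\<lambda>n. fps_nth (Abs_fps (\<lambda>n. 1 / of_nat (Suc n) ^ k)) n * (of_real r ^ n :: complex))"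
  proof (rule summable_comparison_test)
    show "summable (\<lambda>n. r ^ n)" using r by simp
    \<comment> \<open>The coefficients are at most 1 for every \<open>k\<close>, including
      \<open>k = 0\<close>, so a geometric series dominates.\<close>
    have "1 / real (Suc n) ^ k * r ^ n \<le> 1 * r ^ n" for n
      using r by (intro mult_right_mono) (auto simp: divide_le_eq)
    then show "\<exists>N. \<forall>n\<ge>N. norm (fps_nth (Abs_fps (\<lambda>n. 1 / of_nat (Suc n) ^ k)) n
        * (of_real r ^ n :: complex)) \<le> r ^ n"
      using r by (simp add: norm_mult norm_divide norm_power del: of_nat_Suc)
  qed
qed

text \<open>Pulling out one factor \<open>x\<close> exhibits the simple zero at 0: the remaining
  series has constant term 1.\<close>

lemma of_real_polylog:
  assumes "\<bar>x\<bar> < 1"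
  shows "complex_of_real (polylog k x) =
    of_real x * eval_fps (Abs_fps (\<lambda>n. 1 / of_nat (Suc n) ^ k)) (of_real x)"
proof -
  let ?P = "Abs_fps (\<lambda>n. 1 / of_nat (Suc n) ^ k) :: complex fps"
  have "ereal (norm (complex_of_real x)) < fps_conv_radius ?P"
    using assms by (intro less_le_trans[OF _ fps_conv_radius_polylog]) simp
  then have "(\<lambda>n. of_real x * (fps_nth ?P n * of_real x ^ n)) sums (of_real x * eval_fps ?P (of_real x))"
    by (intro sums_mult sums_eval_fps)
  also have "(\<lambda>n. of_real x * (fps_nth ?P n * of_real x ^ n)) =
      (\<lambda>n. complex_of_real (x ^ Suc n / real (Suc n) ^ k))"
    by (simp add: fun_eq_iff del: of_nat_Suc)
  finally have s: "(\<lambda>n. complex_of_real (x ^ Suc n / real (Suc n) ^ k)) sums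
      (of_real x * eval_fps ?P (of_real x))" .
  have "(\<lambda>n. x ^ Suc n / real (Suc n) ^ k) sums polylog k x"
    unfolding polylog_def using sums_Re[OF s] by (simp add: sums_iff del: of_real_divide of_real_power)
  from sums_unique2[OF sums_of_real[OF this] s] show ?thesis .
qed

text \<open>Numerator and denominator extend to functions \<open>f\<close> and \<open>g\<close>
  analytic at 0, each with a simple zero of derivative 1. Their quotient thus has a power series
  with constant term 1.\<close>

lemma has_egf_poly_Daehee_gf:
  obtains d where "has_egf (poly_Daehee_gf k \<gamma>) d" "d 0 \<noteq> 0"
proof -
  define P :: "complex fps" where "P = Abs_fps (\<lambda>n. 1 / of_nat (Suc n) ^ k)"
  define f :: "complex \<Rightarrow> complex" where "f = (\<lambda>z. (1 + z) powr of_real \<gamma> * Ln (1 + z))"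
  define g :: "complex \<Rightarrow> complex" where "g = (\<lambda>z. (1 - exp (-z)) * eval_fps P (1 - exp (-z)))"
  define F G where "F = fps_expansion f 0" and "G = fps_expansion g 0"
  have P: "fps_conv_radius P > 0"
    using fps_conv_radius_polylog[of k] unfolding P_def by (rule less_le_trans[rotated]) simp
  have "f analytic_on {0}"
    unfolding f_def by (auto intro!: analytic_intros)
  then have F: "f has_fps_expansion F"
    unfolding F_def by (rule analytic_at_imp_has_fps_expansion_0)
  \<comment> \<open>The inner function maps 0 to 0, the centre of the disc of convergence of
    \<open>P\<close>.\<close>
  have ana: "eval_fps P \<circ> (\<lambda>z. 1 - exp (-z)) analytic_on {0}"
    using P by (intro analytic_on_compose analytic_on_eval_fps) (auto intro!: analytic_intros simp: zero_ereal_def)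
  then have "g analytic_on {0}"
    unfolding g_def o_def by (rule analytic_on_mult[rotated]) (intro analytic_intros)
  then have G: "g has_fps_expansion G"
    unfolding G_def by (rule analytic_at_imp_has_fps_expansion_0)
  have "(f has_field_derivative 1) (at 0)"
    unfolding f_def by (auto intro!: derivative_eq_intros)
  then have F1: "fps_nth F 0 = 0" "fps_nth F 1 = 1"
    using fps_nth_fps_expansion[OF F, of 0] fps_nth_fps_expansion[OF F, of 1]
    by (auto simp: f_def DERIV_imp_deriv)
  \<comment> \<open>In the product rule \<open>v\<close> is multiplied by
    \<open>1 - exp 0 = 0\<close>, so the derivative of \<open>g\<close> at 0 is the constant term 1
    of \<open>P\<close>.\<close>
  obtain v where "(eval_fps P \<circ> (\<lambda>z. 1 - exp (-z)) has_field_derivative v) (at 0)"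
    using ana analytic_on_imp_differentiable_at[of _ "{0}" 0] by (auto simp: field_differentiable_def)
  moreover have "((\<lambda>z::complex. 1 - exp (-z)) has_field_derivative 1) (at 0)"
    by (auto intro!: derivative_eq_intros)
  ultimately have "(g has_field_derivative 1) (at 0)"
    unfolding g_def o_def using DERIV_mult by (fastforce simp: eval_fps_at_0 P_def)
  then have G1: "fps_nth G 0 = 0" "fps_nth G 1 = 1"
    using fps_nth_fps_expansion[OF G, of 0] fps_nth_fps_expansion[OF G, of 1]
    by (auto simp: g_def DERIV_imp_deriv)
  have sub: "subdegree F = 1" "subdegree G = 1"
    using F1 G1 by (auto intro!: subdegreeI)
  \<comment> \<open>The value 1 at the removable singularity is the quotient of the two linear
    coefficients.\<close>
  have FG: "(\<lambda>z. if z = 0 then 1 else f z / g z) has_fps_expansion (F / G)"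
    using F1 G1 sub by (intro has_fps_expansion_divide F G) auto
  have "has_egf (\<lambda>x. complex_of_real (poly_Daehee_gf k \<gamma> x)) (\<lambda>n. fact n * fps_nth (F / G) n)"
  proof (rule has_egfI)
    show "fps_conv_radius (F / G) > 0"
      using FG by (simp add: has_fps_expansion_def)
    have "filterlim complex_of_real (nhds 0) (at 0)"
      by (auto intro!: tendsto_eq_intros)
    with FG have "\<forall>\<^sub>F x in at 0. eval_fps (F / G) (complex_of_real x) =
        (if complex_of_real x = 0 then 1 else f (of_real x) / g (of_real x))"
      unfolding has_fps_expansion_def filterlim_iff by blast
    moreover have "\<forall>\<^sub>F x::real in at 0. x \<noteq> 0"
      by (simp add: eventually_at_filter)
    \<comment> \<open>This gives \<open>1 + x > 0\<close>, where the principal complex power and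
      logarithm agree with the real ones. The next bound puts the argument of the polylogarithm
      inside its disc of convergence.\<close>
    moreover have "\<forall>\<^sub>F x::real in at 0. \<bar>x\<bar> < 1"
      by (auto simp: eventually_at intro!: exI[of _ 1])
    moreover have "\<forall>\<^sub>F x::real in at 0. \<bar>1 - exp (- x)\<bar> < 1"
    proof (rule order_tendstoD(2))
      show "((\<lambda>x::real. \<bar>1 - exp (- x)\<bar>) \<longlongrightarrow> 0) (at 0)"
        by (auto intro!: tendsto_eq_intros)
    qed simp
    ultimately show "\<forall>\<^sub>F x in at 0. complex_of_real (poly_Daehee_gf k \<gamma> x) = eval_fps (F / G) (of_real x)"
    proof eventually_elim
      case (elim x)
      have "complex_of_real (polylog k (1 - exp (- x))) = g (of_real x)"
        using of_real_polylog[OF elim(4), of k] by (simp add: g_def P_def exp_of_real flip: of_real_minus)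
      moreover have "complex_of_real ((1 + x) powr \<gamma> * ln (1 + x)) = f (of_real x)"
      proof -
        have "1 + complex_of_real x = of_real (1 + x)" by simp
        then show ?thesis
          using elim(3) by (simp only: f_def) (simp add: powr_of_real Ln_of_real del: of_real_add)
      qed
      ultimately show ?case
        using elim(1,2) by (simp add: poly_Daehee_gf_def)
    qed
  qed
  from has_egf_Re[OF this] have "has_egf (poly_Daehee_gf k \<gamma>) (\<lambda>n. Re (fact n * fps_nth (F / G) n))"
    by simp
  moreover have "fps_nth (F / G) 0 = 1"
    using has_fps_expansion_imp_0_eq_fps_nth_0[OF FG] by simp
  ultimately show thesis
    using that by simp
qed

section \<open>The binomial convolution\<close>

theorem theorem2p1:
  fixes \<gamma> \<eta> lam :: real and a :: complex and k m n :: nat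
  assumes "m \<ge> 1"
  shows "GABPDP k m a n \<gamma> \<eta> lam =
    (\<Sum>j=0..n. of_nat (n choose j) * of_real (poly_Daehee k (n - j) \<gamma>)
                 * apostol_bernoulli m a j \<eta> lam)"
proof -
  let ?D = "\<lambda>x. complex_of_real (poly_Daehee_gf k \<gamma> x)"
  let ?B = "apostol_bernoulli_gf m a \<eta> lam"
  obtain d where d: "has_egf (poly_Daehee_gf k \<gamma>) d" "d 0 \<noteq> 0"
    by (rule has_egf_poly_Daehee_gf)
  have D: "has_egf ?D (\<lambda>n. of_real (d n))"
    using d(1) by (rule has_egf_of_real)
  have gf: "GABPDP_gf k m a \<gamma> \<eta> lam = (\<lambda>x. ?D x * ?B x)"
    by (simp add: fun_eq_iff GABPDP_gf_def poly_Daehee_gf_def apostol_bernoulli_gf_def)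
  show ?thesis
  proof (cases "\<exists>b. has_egf ?B b")
    case True
    then obtain b where b: "has_egf ?B b" by blast
    show ?thesis
      using egf_coeff_eqI[OF has_egf_mult[OF D b]] egf_coeff_eqI[OF b] egf_coeff_eqI[OF d(1)]
      by (simp add: GABPDP_def gf poly_Daehee_def apostol_bernoulli_def)
  next
    case False
    have "\<nexists>c. has_egf (GABPDP_gf k m a \<gamma> \<eta> lam) c"
    proof
      assume "\<exists>c. has_egf (GABPDP_gf k m a \<gamma> \<eta> lam) c"
      then obtain c where c: "has_egf (\<lambda>x. ?D x * ?B x) c"
        by (auto simp: gf)
      obtain e where e: "has_egf (\<lambda>x. inverse (?D x)) e" "\<forall>\<^sub>F x in at 0. ?D x \<noteq> 0"
        using has_egf_inverse[OF D] d(2) by auto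
      \<comment> \<open>The left side has an expansion as a product of two expandable functions, so
        \<open>?B\<close> would have one too, against the case assumption.\<close>
      from e(2) have "\<forall>\<^sub>F x in at 0. inverse (?D x) * (?D x * ?B x) = ?B x"
        by eventually_elim simp
      from has_egf_cong[OF this] has_egf_mult[OF e(1) c] False show False
        by blast
    qed
    \<comment> \<open>Here \<open>egf_coeff\<close> takes its default value 0 both for the left side
      and for the Apostol-Bernoulli factor of every summand.\<close>
    with False show ?thesis
      by (simp add: GABPDP_def apostol_bernoulli_def egf_coeff_def)
  qed
qed

end
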